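(* Let $D\subseteq\mathbb{C}$ be an open disk, let $A\subseteq\mathbb{C}$ be an arc with a ULAC function $g$, and let $\zeta_0 \in A \cap D$. Suppose $k\in\mathbb{N}$ and $\zeta_1 \in D - A$ satisfy $|\zeta_0-\zeta_1| < 2^{-g(k)}$ and $2^{-g(k)} + 2^{-k} \le \max\{d(\zeta_0,\partial D), d(\zeta_1,\partial D)\}$. Then $\zeta_0$ is a boundary point of the connected component of $\zeta_1$ in $D - A$.
   Context: An arc is the image of a continuous injective map $[0,1]\to\mathbb{C}$. A ULAC function for a set $X\subseteq\mathbb{C}$ is a function $f:\mathbb{N}\to\mathbb{N}$ such that whenever $k\in\mathbb{N}$ and $z_0,z_1$ are distinct points of $X$ with $|z_0-z_1|\le 2^{-f(k)}$, there is an arc $B\subseteq X$ from $z_0$ to $z_1$ whose diameter is smaller than $2^{-k}$. For $p\in\mathbb{C}$ and $Y\subseteq\mathbb{C}$, $d(p,Y)=\inf\{|p-w|: w\in Y\}$. *)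

theory Defs
  imports "HOL-Analysis.Analysis"
begin

text \<open>Arcs are point sets here; the library predicate \<^const>\<open>arc\<close> is about parametrisations.\<close>

definition is_arc :: "complex set \<Rightarrow> bool" where
  "is_arc A \<longleftrightarrow> (\<exists>\<gamma>. arc \<gamma> \<and> path_image \<gamma> = A)"

definition is_arc_from_to :: "complex set \<Rightarrow> complex \<Rightarrow> complex \<Rightarrow> bool" where
  "is_arc_from_to B z0 z1 \<longleftrightarrow>
     (\<exists>\<gamma>. arc \<gamma> \<and> path_image \<gamma> = B \<and> pathstart \<gamma> = z0 \<and> pathfinish \<gamma> = z1)"

definition ULAC_function :: "(nat \<Rightarrow> nat) \<Rightarrow> complex set \<Rightarrow> bool" where
  "ULAC_function f X \<longleftrightarrow>
     (\<forall>k. \<forall>z0\<in>X. \<forall>z1\<in>X. z0 \<noteq> z1 \<longrightarrow> dist z0 z1 \<le> 2 powr (- real (f k)) \<longrightarrow>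
        (\<exists>B. B \<subseteq> X \<and> is_arc_from_to B z0 z1 \<and> diameter B < 2 powr (- real k)))"

end

theory Submission
  imports Defs
begin

text \<open>
  Let U be the component of \<zeta>1 in D - A, put \<rho> = 2 powr (-g k), and suppose that U stays away from
  a neighbourhood N of \<zeta>0.  Let J be a subarc of A around \<zeta>0 that contains all points of A in the
  disk of radius \<rho> about \<zeta>0 and whose endpoints lie in that disk (or are endpoints of A).
  The ULAC property and the hypothesis on the distance to the boundary
  force J to lie in D.  Removing N from J leaves two arcs, each of which meets the union of
  A - J, the complement of D and the other arc in at most one point.  The segment from
  \<zeta>0 to \<zeta>1 misses A - J and the complement of D, so two applications of Janiszewski's theorem
  show that \<zeta>0 and \<zeta>1 are not separated by the complement of D together with A - N.
  But the frontier of U is contained in that set.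
\<close>

text \<open>Take the least \<open>s\<close> with \<open>f s \<le> \<rho>\<close>. If
  \<open>s \<noteq> a\<close>, then \<open>f\<close> exceeds \<open>\<rho>\<close> before
  \<open>s\<close>, and the intermediate value theorem forces \<open>f s = \<rho>\<close>. The guard
  \<open>s \<noteq> a\<close> is there because \<open>f a\<close> may lie strictly below
  \<open>\<rho>\<close>.\<close>

lemma first_entry_time:
  fixes f :: "real \<Rightarrow> real"
  assumes "a \<le> b" "continuous_on {a..b} f" "f b \<le> \<rho>"
  obtains s where "s \<in> {a..b}" "f s \<le> \<rho>" "\<And>u. u \<in> {a..s} \<Longrightarrow> s \<noteq> a \<Longrightarrow> \<rho> \<le> f u"
proof (cases "f a \<le> \<rho>")
  case True
  then show ?thesis using that[of a] assms(1) by auto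
next
  case False
  define S where "S = {u \<in> {a..b}. f u \<le> \<rho>}"
  have "closed S"
    unfolding S_def
    by (intro continuous_on_closed_Collect_le[OF assms(2)] continuous_on_const closed_atLeastAtMost)
  moreover have "bounded S"
    by (rule bounded_subset[OF bounded_closed_interval[of a b]]) (auto simp: S_def)
  ultimately have "compact S" by (simp add: compact_eq_bounded_closed)
  moreover have "b \<in> S" using assms by (auto simp: S_def)
  ultimately obtain s where s: "s \<in> S" and smin: "\<And>u. u \<in> S \<Longrightarrow> s \<le> u"
    using compact_attains_inf[of S] by blast
  have above: "\<rho> < f u" if "u \<in> {a..<s}" for u
    using smin[of u] that s by (force simp: S_def)
  have "continuous_on {a..s} f"
    using assms(2) by (rule continuous_on_subset) (use s in \<open>auto simp: S_def\<close>)
  then obtain x where x: "a \<le> x" "x \<le> s" "f x = \<rho>"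
    using IVT2'[of f s \<rho> a] False s by (auto simp: S_def)
  then have "x = s" using above[of x] by force
  with x have "f s = \<rho>" by simp
  moreover have "\<rho> \<le> f u" if "u \<in> {a..s}" for u
    using above[of u] that \<open>f s = \<rho>\<close> by (cases "u = s") auto
  ultimately show ?thesis
    using s by (intro that[of s]) (auto simp: S_def)
qed

lemma last_exit_time:
  fixes f :: "real \<Rightarrow> real"
  assumes "a \<le> b" "continuous_on {a..b} f" "f a \<le> \<rho>"
  obtains t where "t \<in> {a..b}" "f t \<le> \<rho>" "\<And>u. u \<in> {t..b} \<Longrightarrow> t \<noteq> b \<Longrightarrow> \<rho> \<le> f u"
proof -
  have "continuous_on {-b..-a} (\<lambda>u. f (- u))"
    by (rule continuous_on_compose2[OF assms(2)]) (auto intro!: continuous_intros)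
  then obtain s where s: "s \<in> {-b..-a}" "f (- s) \<le> \<rho>"
      and out: "\<And>u. u \<in> {-b..s} \<Longrightarrow> s \<noteq> -b \<Longrightarrow> \<rho> \<le> f (- u)"
    using first_entry_time[of "-b" "-a" "\<lambda>u. f (- u)" \<rho>] assms by auto
  show ?thesis
  proof (rule that[of "-s"])
    show "\<rho> \<le> f u" if "u \<in> {-s..b}" "-s \<noteq> b" for u
      using out[of "-u"] that by auto
  qed (use s in auto)
qed

text \<open>An arc is homeomorphic to its parameter interval, so \<open>B\<close> pulls back to a
  connected set of reals, which contains everything between \<open>s\<close> and
  \<open>t\<close>.\<close>

lemma arc_segment_subset_connected:
  fixes \<gamma> :: "real \<Rightarrow> 'a::t2_space"
  assumes "arc \<gamma>" "connected B" "B \<subseteq> path_image \<gamma>"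
    and "s \<in> {0..1}" "t \<in> {0..1}" "\<gamma> s \<in> B" "\<gamma> t \<in> B" "u \<in> {s..t}"
  shows "\<gamma> u \<in> B"
proof -
  obtain h where hom: "homeomorphism {0..1} (path_image \<gamma>) \<gamma> h"
    using homeomorphism_arc[OF assms(1)] by blast
  have "connected (h ` B)"
    by (rule connected_continuous_image[OF _ assms(2)])
       (use hom assms(3) in \<open>auto simp: homeomorphism_def intro: continuous_on_subset\<close>)
  moreover have "s \<in> h ` B" "t \<in> h ` B"
    using assms homeomorphism_apply1[OF hom] by (metis image_eqI)+
  ultimately have "u \<in> h ` B"
    using assms(8) by (auto intro: connectedD_interval)
  then show ?thesis
    using assms(3) homeomorphism_apply2[OF hom] by auto
qed

lemma arc_image_interval:
  fixes \<gamma> :: "real \<Rightarrow> complex"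
  assumes "arc \<gamma>" "{a..b} \<subseteq> {0..1}"
  shows "compact (\<gamma> ` {a..b})" "connected (- \<gamma> ` {a..b})"
proof -
  have cont: "continuous_on {a..b} \<gamma>"
    using assms by (auto simp: arc_def path_def intro: continuous_on_subset)
  then show "compact (\<gamma> ` {a..b})"
    by (intro compact_continuous_image) auto
  have "inj_on \<gamma> {a..b}"
    using assms by (auto simp: arc_def intro: inj_on_subset)
  then have "{a..b} homeomorphic \<gamma> ` {a..b}"
    using cont by (metis homeomorphic_compact compact_Icc)
  then have "\<gamma> ` {a..b} homeomorphic {a..b}"
    by (rule homeomorphic_sym[THEN iffD1])
  then show "connected (- \<gamma> ` {a..b})"
    by (rule connected_complement_homeomorphic_convex_compact[where T="{a..b}"]) auto
qed

text \<open>Janiszewski's theorem for a subarc, which by itself never separates the plane. Meeting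
  \<open>T\<close> in at most one point is what makes the intersection connected. The interval may
  be empty.\<close>

lemma connected_component_Compl_Un_arc:
  fixes \<gamma> :: "real \<Rightarrow> complex"
  assumes "arc \<gamma>" "{a..b} \<subseteq> {0..1}" "closed T"
    and "\<gamma> ` {a..b} \<inter> T \<subseteq> {p}" and "x \<notin> \<gamma> ` {a..b}" "y \<notin> \<gamma> ` {a..b}"
    and "connected_component (- T) x y"
  shows "connected_component (- (\<gamma> ` {a..b} \<union> T)) x y"
proof (rule Janiszewski)
  have "\<gamma> ` {a..b} \<inter> T = {} \<or> \<gamma> ` {a..b} \<inter> T = {p}"
    using assms(4) by blast
  then show "connected (\<gamma> ` {a..b} \<inter> T)"
    by (metis connected_empty connected_sing)
  show "connected_component (- \<gamma> ` {a..b}) x y"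
    using arc_image_interval(2)[OF assms(1,2)] assms(5,6)
    by (auto simp: connected_iff_connected_component)
qed (use assms arc_image_interval(1)[OF assms(1,2)] in auto)

text \<open>A ball about a point of \<open>D\<close> that left \<open>D\<close> would, being
  connected, meet the frontier at distance less than \<open>\<delta>\<close>.\<close>

lemma ball_subset_infdist_frontier:
  fixes D :: "'a::euclidean_space set"
  assumes "x \<in> D" "\<delta> \<le> infdist x (frontier D)"
  shows "ball x \<delta> \<subseteq> D"
proof (rule ccontr)
  assume "\<not> ball x \<delta> \<subseteq> D"
  then have ne: "ball x \<delta> - D \<noteq> {}" by auto
  then have "\<delta> > 0"
    by (metis Diff_empty ball_empty empty_Diff not_le)
  then have "x \<in> ball x \<delta>" by simp
  then have "ball x \<delta> \<inter> frontier D \<noteq> {}"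
    using connected_Int_frontier[OF connected_ball] assms(1) ne by blast
  then obtain y where "y \<in> frontier D" "dist x y < \<delta>" by auto
  then show False
    using infdist_le[of y "frontier D" x] assms(2) by linarith
qed

text \<open>Components of the open set \<open>D - A\<close> are open, so a point of
  \<open>D - A\<close> in the closure of one component already belongs to it and is
  interior.\<close>

lemma frontier_component_diff_subset:
  fixes D A :: "'a::real_normed_vector set"
  assumes "open D" "closed A" "x \<in> D"
    and "x \<in> frontier (connected_component_set (D - A) p)"
  shows "x \<in> A"
proof (rule ccontr)
  assume "x \<notin> A"
  define U where "U = connected_component_set (D - A) p"
  have op: "open (D - A)" using assms by blast
  have "open U" unfolding U_def by (rule open_connected_component[OF op])
  have "open (connected_component_set (D - A) x)"
    by (rule open_connected_component[OF op])
  moreover have "x \<in> connected_component_set (D - A) x"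
    using assms \<open>x \<notin> A\<close> by simp
  moreover have "x \<in> closure U"
    using assms(4) by (simp add: frontier_def U_def)
  ultimately have "connected_component_set (D - A) x \<inter> U \<noteq> {}"
    by (metis IntI empty_iff open_Int_closure_eq_empty)
  then have "connected_component (D - A) x p"
    by (auto simp: U_def intro: connected_component_trans connected_component_sym)
  then have "x \<in> U"
    by (simp add: U_def connected_component_sym)
  then show False
    using assms(4) \<open>open U\<close> by (simp add: frontier_def U_def interior_open)
qed

text \<open>The small arc \<open>B\<close> given by the ULAC property is a connected subset of the
  arc containing both endpoints, so it contains the whole piece of \<open>\<gamma>\<close> between
  them, and its diameter bounds that piece. The property speaks of distinct points only, hence the
  separate case \<open>s = t\<close>.\<close>

lemma ULAC_subarc_in_ball:
  assumes "arc \<gamma>" "ULAC_function g (path_image \<gamma>)"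
    and "s \<in> {0..1}" "t \<in> {0..1}" "dist (\<gamma> s) (\<gamma> t) \<le> 2 powr (- real (g k))"
    and "p \<in> {s, t}" "u \<in> {s..t}"
  shows "\<gamma> u \<in> ball (\<gamma> p) (2 powr (- real k))"
proof (cases "s = t")
  case True
  then show ?thesis using assms by auto
next
  case False
  have mem: "\<gamma> s \<in> path_image \<gamma>" "\<gamma> t \<in> path_image \<gamma>"
    using assms by (auto simp: path_image_def)
  have "\<gamma> s \<noteq> \<gamma> t"
    using assms False by (auto simp: arc_def dest: inj_onD)
  then obtain B where B: "B \<subseteq> path_image \<gamma>" "is_arc_from_to B (\<gamma> s) (\<gamma> t)"
      "diameter B < 2 powr (- real k)"
    using assms(2,5) mem unfolding ULAC_function_def by blast
  then obtain \<delta> where \<delta>: "arc \<delta>" "path_image \<delta> = B" "pathstart \<delta> = \<gamma> s" "pathfinish \<delta> = \<gamma> t"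
    by (auto simp: is_arc_from_to_def)
  have ends: "\<gamma> s \<in> B" "\<gamma> t \<in> B"
    using \<delta> by (metis pathstart_in_path_image pathfinish_in_path_image)+
  have "connected B" "bounded B"
    using \<delta> by (auto simp: arc_imp_path connected_path_image bounded_path_image)
  then have "\<gamma> u \<in> B"
    using arc_segment_subset_connected[OF assms(1) _ B(1) assms(3,4) ends assms(7)] by blast
  moreover have "\<gamma> p \<in> B" using assms(6) ends by auto
  ultimately have "dist (\<gamma> p) (\<gamma> u) \<le> diameter B"
    using diameter_bounded_bound[OF \<open>bounded B\<close>] by blast
  then show ?thesis using B(3) by simp
qed

theorem theorem5p3:
  fixes D A :: "complex set" and c \<zeta>0 \<zeta>1 :: complex and r :: real
    and g :: "nat \<Rightarrow> nat" and k :: nat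
  assumes "r > 0" and "D = ball c r"
    and "is_arc A" and "ULAC_function g A"
    and "\<zeta>0 \<in> A \<inter> D" and "\<zeta>1 \<in> D - A"
    and "dist \<zeta>0 \<zeta>1 < 2 powr (- real (g k))"
    and "2 powr (- real (g k)) + 2 powr (- real k)
           \<le> max (infdist \<zeta>0 (frontier D)) (infdist \<zeta>1 (frontier D))"
  shows "\<zeta>0 \<in> frontier (connected_component_set (D - A) \<zeta>1)"
proof (rule ccontr)
  define \<rho> where "\<rho> = 2 powr (- real (g k))"
  define \<epsilon> where "\<epsilon> = 2 powr (- real k)"
  define U where "U = connected_component_set (D - A) \<zeta>1"
  assume "\<zeta>0 \<notin> frontier (connected_component_set (D - A) \<zeta>1)"
  then have not_frontier: "\<zeta>0 \<notin> frontier U" by (simp add: U_def)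
  have D: "open D" "convex D" using assms(2) by auto
  have "\<rho> > 0" by (simp add: \<rho>_def)
  obtain \<gamma> where \<gamma>: "arc \<gamma>" "path_image \<gamma> = A"
    using assms(3) by (auto simp: is_arc_def)
  have cont: "continuous_on {0..1} \<gamma>" and inj: "inj_on \<gamma> {0..1}"
    using \<gamma>(1) by (auto simp: arc_def path_def)
  have "closed A"
    using \<gamma> by (metis arc_imp_path closed_path_image)
  obtain p where p: "p \<in> {0..1}" "\<gamma> p = \<zeta>0"
    using assms(5) \<gamma>(2) by (auto simp: path_image_def)

  \<comment> \<open>If the maximum is attained at \<open>\<zeta>1\<close>, the summand
    \<open>\<rho>\<close> pays for moving the centre from \<open>\<zeta>1\<close> to
    \<open>\<zeta>0\<close>.\<close>
  have small: "ball \<zeta>0 \<epsilon> \<subseteq> D"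
  proof (cases "\<rho> + \<epsilon> \<le> infdist \<zeta>0 (frontier D)")
    case True
    then have "ball \<zeta>0 (\<rho> + \<epsilon>) \<subseteq> D"
      using assms(5) by (intro ball_subset_infdist_frontier) auto
    moreover have "ball \<zeta>0 \<epsilon> \<subseteq> ball \<zeta>0 (\<rho> + \<epsilon>)"
      using \<open>\<rho> > 0\<close> by (intro subset_ball) auto
    ultimately show ?thesis by blast
  next
    case False
    then have "\<rho> + \<epsilon> \<le> infdist \<zeta>1 (frontier D)"
      using assms(8) by (auto simp: \<rho>_def \<epsilon>_def max_def split: if_splits)
    then have "ball \<zeta>1 (\<rho> + \<epsilon>) \<subseteq> D"
      using assms(6) by (intro ball_subset_infdist_frontier) auto
    moreover have "ball \<zeta>0 \<epsilon> \<subseteq> ball \<zeta>1 (\<rho> + \<epsilon>)"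
    proof
      fix z assume "z \<in> ball \<zeta>0 \<epsilon>"
      then show "z \<in> ball \<zeta>1 (\<rho> + \<epsilon>)"
        using dist_triangle[of \<zeta>1 z \<zeta>0] assms(7) by (simp add: \<rho>_def dist_commute)
    qed
    ultimately show ?thesis by blast
  qed

  have dist_cont: "continuous_on {0..1} (\<lambda>u. dist (\<gamma> u) \<zeta>0)"
    using cont by (intro continuous_intros)
  obtain s where s: "s \<in> {0..p}" "dist (\<gamma> s) \<zeta>0 \<le> \<rho>"
      and s_out: "\<And>u. u \<in> {0..s} \<Longrightarrow> s \<noteq> 0 \<Longrightarrow> \<rho> \<le> dist (\<gamma> u) \<zeta>0"
  proof (rule first_entry_time[of 0 p "\<lambda>u. dist (\<gamma> u) \<zeta>0" \<rho>])
    show "continuous_on {0..p} (\<lambda>u. dist (\<gamma> u) \<zeta>0)"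
      using dist_cont by (rule continuous_on_subset) (use p in auto)
  qed (use p \<open>\<rho> > 0\<close> in auto)
  obtain t where t: "t \<in> {p..1}" "dist (\<gamma> t) \<zeta>0 \<le> \<rho>"
      and t_out: "\<And>u. u \<in> {t..1} \<Longrightarrow> t \<noteq> 1 \<Longrightarrow> \<rho> \<le> dist (\<gamma> u) \<zeta>0"
  proof (rule last_exit_time[of p 1 "\<lambda>u. dist (\<gamma> u) \<zeta>0" \<rho>])
    show "continuous_on {p..1} (\<lambda>u. dist (\<gamma> u) \<zeta>0)"
      using dist_cont by (rule continuous_on_subset) (use p in auto)
  qed (use p \<open>\<rho> > 0\<close> in auto)

  \<comment> \<open>The pieces over \<open>{s..p}\<close> and \<open>{p..t}\<close> are treated
    separately: each has \<open>\<zeta>0\<close> as an endpoint and its other endpoint within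
    \<open>\<rho>\<close> of it, so each stays in \<open>ball \<zeta>0 \<epsilon>\<close>.\<close>
  have in_D: "\<gamma> u \<in> D" if "u \<in> {s..t}" for u
  proof -
    have "\<gamma> u \<in> ball (\<gamma> p) \<epsilon>"
    proof (cases "u \<le> p")
      case True
      show ?thesis unfolding \<epsilon>_def
        by (rule ULAC_subarc_in_ball[OF \<gamma>(1), of g s p])
           (use True that assms(4) \<gamma>(2) p s in \<open>auto simp: \<rho>_def\<close>)
    next
      case False
      show ?thesis unfolding \<epsilon>_def
        by (rule ULAC_subarc_in_ball[OF \<gamma>(1), of g p t])
           (use False that assms(4) \<gamma>(2) p t in \<open>auto simp: \<rho>_def dist_commute\<close>)
    qed
    with small p show ?thesis by auto
  qed

  have "\<zeta>0 \<notin> U"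
    using assms(5) connected_component_subset[of "D - A" \<zeta>1] by (auto simp: U_def)
  then have "\<zeta>0 \<notin> closure U"
    using not_frontier interior_subset[of U] by (auto simp: frontier_def)
  then obtain \<eta> where \<eta>: "\<eta> > 0" "ball \<zeta>0 \<eta> \<inter> closure U = {}"
    by (metis ComplI closed_closure disjoint_eq_subset_Compl openE open_Compl)
  \<comment> \<open>Parameters within \<open>h\<close> of \<open>p\<close> give points of
    \<open>A\<close> outside the closure of \<open>U\<close>; this is the portion of the arc that
    can be removed.\<close>
  obtain h where h: "h > 0" "\<And>u. u \<in> {0..1} \<Longrightarrow> dist u p < h \<Longrightarrow> dist (\<gamma> u) \<zeta>0 < \<eta>"
    using cont p \<eta>(1) unfolding continuous_on_iff by metis

  \<comment> \<open>If s = 0, the entry point \<gamma> 0 may lie inside the disk of radius \<rho>, so the outer left part has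
     to be empty; likewise on the right if t = 1.\<close>
  define P1 where "P1 = \<gamma> ` (if s = 0 then {} else {0..s})"
  define P2 where "P2 = \<gamma> ` (if t = 1 then {} else {t..1})"
  define J1 where "J1 = \<gamma> ` {s..p - h}"
  define J2 where "J2 = \<gamma> ` {p + h..t}"
  define Q where "Q = - D \<union> P1 \<union> P2"

  have "compact P1" "compact P2"
    using arc_image_interval(1)[OF \<gamma>(1), of 0 s] arc_image_interval(1)[OF \<gamma>(1), of t 1] s t p
    by (auto simp: P1_def P2_def)
  then have "closed Q"
    using D(1) by (simp add: Q_def compact_imp_closed closed_Un closed_Compl)
  have I1: "{s..p - h} \<subseteq> {0..1}" and I2: "{p + h..t} \<subseteq> {0..1}"
    using s t p h(1) by auto
  have "compact J1"
    unfolding J1_def by (rule arc_image_interval(1)[OF \<gamma>(1) I1])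
  \<comment> \<open>\<open>J1\<close> lies in \<open>D\<close>, so only \<open>P1\<close> and
    \<open>P2\<close> matter. By injectivity it suffices to compare parameters:
    \<open>{s..p - h}\<close> meets \<open>{0..s}\<close> at most in \<open>s\<close>, and misses
    \<open>{t..1}\<close> because \<open>p - h < p \<le> t\<close>.\<close>
  have J1Q: "J1 \<inter> Q \<subseteq> {\<gamma> s}"
  proof
    fix x assume "x \<in> J1 \<inter> Q"
    then obtain u where u: "u \<in> {s..p - h}" "x = \<gamma> u" "x \<in> Q" by (auto simp: J1_def)
    have "x \<in> D" using u in_D[of u] t h(1) by auto
    then have "\<gamma> u \<in> \<gamma> ` ({0..s} \<union> {t..1})"
      using u(2,3) unfolding Q_def P1_def P2_def image_Un by (auto split: if_splits)
    then obtain v where v: "v \<in> {0..s} \<union> {t..1}" "\<gamma> v = \<gamma> u"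
      by (metis imageE)
    have "v \<in> {0..1}" "u \<in> {0..1}" using v(1) u(1) I1 s t p by auto
    then have "v = u" using v inj by (auto dest: inj_onD)
    with v u t h(1) show "x \<in> {\<gamma> s}" by auto
  qed
  have J2Q: "J2 \<inter> (J1 \<union> Q) \<subseteq> {\<gamma> t}"
  proof
    fix x assume "x \<in> J2 \<inter> (J1 \<union> Q)"
    then obtain u where u: "u \<in> {p + h..t}" "x = \<gamma> u" "x \<in> J1 \<union> Q" by (auto simp: J2_def)
    have "x \<in> D" using u in_D[of u] s h(1) by auto
    then have "\<gamma> u \<in> \<gamma> ` ({0..s} \<union> {s..p - h} \<union> {t..1})"
      using u(2,3) unfolding Q_def P1_def P2_def J1_def image_Un by (auto split: if_splits)
    then obtain v where v: "v \<in> {0..s} \<union> {s..p - h} \<union> {t..1}" "\<gamma> v = \<gamma> u"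
      by (metis imageE)
    have "v \<in> {0..1}" "u \<in> {0..1}" using v(1) u(1) I1 I2 s t p by auto
    then have "v = u" using v inj by (auto dest: inj_onD)
    with v u s h(1) show "x \<in> {\<gamma> t}" by auto
  qed

  \<comment> \<open>The strict inequality \<open>dist \<zeta>0 \<zeta>1 < \<rho>\<close> keeps the
    segment in the open disk, while \<open>P1\<close> and \<open>P2\<close> stay at distance at
    least \<open>\<rho>\<close> from its centre.\<close>
  have "connected_component (- Q) \<zeta>1 \<zeta>0"
  proof -
    have "closed_segment \<zeta>1 \<zeta>0 \<subseteq> D"
      using D(2) assms(5,6) by (intro closed_segment_subset) auto
    moreover have "closed_segment \<zeta>1 \<zeta>0 \<subseteq> ball \<zeta>0 \<rho>"
      using \<open>\<rho> > 0\<close> assms(7) by (intro closed_segment_subset) (auto simp: \<rho>_def)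
    moreover have "(P1 \<union> P2) \<inter> ball \<zeta>0 \<rho> = {}"
    proof -
      have "\<rho> \<le> dist z \<zeta>0" if "z \<in> P1 \<union> P2" for z
        using that s_out t_out unfolding P1_def P2_def by (auto split: if_splits)
      then show ?thesis by (force simp: dist_commute)
    qed
    ultimately have "closed_segment \<zeta>1 \<zeta>0 \<subseteq> - Q"
      by (auto simp: Q_def)
    then show ?thesis
      unfolding connected_component_def
      by (intro exI[of _ "closed_segment \<zeta>1 \<zeta>0"]) auto
  qed
  moreover have "\<zeta>1 \<notin> J1" "\<zeta>1 \<notin> J2"
    using assms(6) \<gamma>(2) I1 I2 by (auto simp: J1_def J2_def path_image_def)
  moreover have "\<zeta>0 \<notin> J1" "\<zeta>0 \<notin> J2"
    using p h(1) inj_on_image_mem_iff[OF inj p(1) I1] inj_on_image_mem_iff[OF inj p(1) I2]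
    by (auto simp: J1_def J2_def)
  \<comment> \<open>First \<open>J1\<close> is added to \<open>Q\<close>, then \<open>J2\<close> to
    \<open>J1 \<union> Q\<close>. Both avoid \<open>\<zeta>0\<close> because
    \<open>h > 0\<close>.\<close>
  ultimately have "connected_component (- (J2 \<union> (J1 \<union> Q))) \<zeta>1 \<zeta>0"
    using connected_component_Compl_Un_arc[OF \<gamma>(1) I1 \<open>closed Q\<close>, of "\<gamma> s" \<zeta>1 \<zeta>0]
      connected_component_Compl_Un_arc[OF \<gamma>(1) I2, of "J1 \<union> Q" "\<gamma> t" \<zeta>1 \<zeta>0]
      J1Q J2Q \<open>closed Q\<close> \<open>compact J1\<close>
    by (simp add: J1_def J2_def compact_imp_closed closed_Un)
  then obtain W where W: "connected W" "W \<subseteq> - (J2 \<union> (J1 \<union> Q))" "\<zeta>1 \<in> W" "\<zeta>0 \<in> W"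
    by (auto simp: connected_component_def)
  have "\<zeta>1 \<in> U" using assms(6) by (simp add: U_def)
  \<comment> \<open>\<open>W\<close> joins a point of \<open>U\<close> to a point outside it, so it
    crosses the frontier of \<open>U\<close>.\<close>
  then obtain x where x: "x \<in> W" "x \<in> frontier U"
    using connected_Int_frontier[OF W(1), of U] W \<open>\<zeta>0 \<notin> U\<close> by blast
  have "x \<in> D" using x(1) W(2) by (auto simp: Q_def)
  then have "x \<in> A"
    using frontier_component_diff_subset[OF D(1) \<open>closed A\<close>] x(2) by (auto simp: U_def)
  then obtain u where u: "u \<in> {0..1}" "x = \<gamma> u"
    using \<gamma>(2) by (auto simp: path_image_def)
  have "x \<notin> ball \<zeta>0 \<eta>"
    using x(2) \<eta>(2) by (auto simp: frontier_def)
  then have "h \<le> dist u p"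
    using h(2)[OF u(1)] u(2) by (force simp: dist_commute)
  \<comment> \<open>Dropping \<open>{0..s}\<close> when \<open>s = 0\<close> loses nothing: then
    every \<open>u \<le> p - h\<close> lies in \<open>{s..p - h}\<close>. The case
    \<open>t = 1\<close> is symmetric.\<close>
  then have "u \<in> {s..p - h} \<union> {p + h..t} \<union> (if s = 0 then {} else {0..s}) \<union> (if t = 1 then {} else {t..1})"
    using u(1) by (auto simp: dist_real_def abs_if split: if_splits)
  then have "x \<in> J1 \<union> J2 \<union> P1 \<union> P2"
    unfolding J1_def J2_def P1_def P2_def u(2) by blast
  then show False
    using x(1) W(2) by (auto simp: Q_def)
qed

end
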